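(* Suppose that Assumption 1 (stated in the context) is satisfied by $X$ and $R$. Consider the condition $$\text{(N)}\qquad e_i(n)\notin \mathrm{span}(X)\ \text{ for every } i\in I_1(\mathfrak{M}_0^{lin}),$$ which is equivalent to the condition $$\text{(N')}\qquad h_{ii}<1\ \text{ for every } i\in\{1,\ldots,n\}\text{ satisfying } R(X'X)^{-1}x_{i\cdot}'\neq 0 .$$ For $\alpha\in(0,1)$ and a real number $C(\alpha)$ consider the size-control property $$\text{(S)}\qquad \sup_{\mu_0\in\mathfrak{M}_0}\ \sup_{0<\sigma^2<\infty}\ \sup_{\Sigma\in\mathfrak{C}_{Het}} P_{\mu_0,\sigma^2\Sigma}\bigl(T_{Het}\ge C(\alpha)\bigr)\le\alpha .$$ Then the following statements hold: 1. If (N) (or equivalently (N')) holds, then for every $0<\alpha<1$ there exists a real number $C(\alpha)$ such that (S) holds. Furthermore, under (N) (or equivalently (N')), even equality can be achieved in (S) by a proper choice of $C(\alpha)$, provided $\alpha\in(0,\alpha^*]\cap(0,1)$, where $$\alpha^*=\sup_{C\in(C^*,\infty)}\ \sup_{\Sigma\in\mathfrak{C}_{Het}}P_{\mu_0,\Sigma}(T_{Het}\ge C)$$ is positive and where $$C^*=\max\{T_{Het}(\mu_0+e_i(n)):i\in I_1(\mathfrak{M}_0^{lin})\}$$ for $\mu_0\in\mathfrak{M}_0$ (with neither $\alpha^*$ nor $C^*$ depending on the choice of $\mu_0\in\mathfrak{M}_0$). 2. Suppose (N) (or equivalently (N')) is satisfied. Then for every $0<\alpha<1$ a smallest critical value,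 denoted by $C_\Diamond(\alpha)$, satisfying (S) exists. And $C_\Diamond(\alpha)$ is also the smallest among the critical values leading to equality in (S) whenever such critical values exist. 3. Suppose (N) (or equivalently (N')) is satisfied. Then any $C(\alpha)$ satisfying (S) necessarily has to satisfy $C(\alpha)\ge C^*$. In fact, for any $C<C^*$ we have $\sup_{\Sigma\in\mathfrak{C}_{Het}}P_{\mu_0,\sigma^2\Sigma}(T_{Het}\ge C)=1$ for every $\mu_0\in\mathfrak{M}_0$ and every $\sigma^2\in(0,\infty)$. 4. If (N) (or equivalently (N')) is violated, then $\sup_{\Sigma\in\mathfrak{C}_{Het}}P_{\mu_0,\sigma^2\Sigma}(T_{Het}\ge C)=1$ for every choice of (finite, real) critical value $C$, every $\mu_0\in\mathfrak{M}_0$, and every $\sigma^2\in(0,\infty)$ (implying that the size equals $1$ for every $C$).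
   Context: Setting. $X$ is a real nonstochastic $n\times k$ matrix with $\mathrm{rank}(X)=k$ and $1\le k<n$; $x_{i\cdot}$ is the $i$-th row of $X$; $\mathrm{span}(X)$ is the column space of $X$; a prime denotes transposition. $R\neq 0$ is a real $1\times k$ vector and $r\in\mathbb{R}$ (a single restriction $R\beta=r$ is tested). $e_i(n)$ is the $i$-th standard basis vector of $\mathbb{R}^n$, and $h_{ii}$ is the $i$-th diagonal element of $H=X(X'X)^{-1}X'$. Mean spaces. $\mathfrak{M}_0=\{X\beta:\beta\in\mathbb{R}^k,\ R\beta=r\}$ and $\mathfrak{M}_0^{lin}=\{X\beta:\beta\in\mathbb{R}^k,\ R\beta=0\}$. Index sets. For a linear subspace $\mathcal{L}$ of $\mathbb{R}^n$, $I_0(\mathcal{L})=\{i:1\le i\le n,\ e_i(n)\in\mathcal{L}\}$ and $I_1(\mathcal{L})=\{1,\ldots,n\}\setminus I_0(\mathcal{L})$. Heteroskedasticity model. $\mathfrak{C}_{Het}=\{\mathrm{diag}(\tau_1^2,\ldots,\tau_n^2):\tau_i^2>0 \text{ for all } i,\ \sum_{i=1}^n\tau_i^2=1\}$. $P_{\mu,A}$ denotes the Gaussian probability measure on $\mathbb{R}^n$ with mean $\mu$ and covariance matrix $A$. Test statistic. For $y\in\mathbb{R}^n$ let $\hat\beta(y)=(X'X)^{-1}X'y$, $\hat u(y)=(\hat u_1(y),\ldots,\hat u_n(y))'=y-X\hat\beta(y)$, and, with given constants $d_1,\ldots,d_n>0$ (which may depend on $X$), $$\hat\Psi_{Het}(y)=(X'X)^{-1}X'\mathrm{diag}(d_1\hat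 u_1^2(y),\ldots,d_n\hat u_n^2(y))X(X'X)^{-1},\qquad \hat\Omega_{Het}(y)=R\hat\Psi_{Het}(y)R'.$$ Then $T_{Het}(y)=(R\hat\beta(y)-r)^2/\hat\Omega_{Het}(y)$ if $\hat\Omega_{Het}(y)\neq 0$, and $T_{Het}(y)=0$ if $\hat\Omega_{Het}(y)=0$. Assumption 1. Let $1\le i_1<\ldots<i_s\le n$ denote all the indices for which $e_{i_j}(n)\in\mathrm{span}(X)$ holds; if no such index exists, set $s=0$. Let $X'(\lnot(i_1,\ldots,i_s))$ denote the matrix obtained from $X'$ by deleting all columns with indices $i_j$, $1\le j\le s$ (if $s=0$, no column is deleted). Then $R(X'X)^{-1}X'(\lnot(i_1,\ldots,i_s))\neq 0$ holds. *)

theory Defs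
  imports "HOL-Analysis.Analysis"
begin

definition diag :: "real^'n \<Rightarrow> real^'n^'n" where
  "diag v = (\<chi> i j. if i = j then v $ i else 0)"

text \<open>The Gaussian measure, given by its Lebesgue density. It is the intended measure only for
  symmetric positive definite \<open>A\<close>; below it is only applied to \<open>\<sigma>\<^sup>2 \<Sigma>\<close> with \<open>\<sigma>\<^sup>2 > 0\<close> and
  \<open>\<Sigma>\<close> diagonal with positive diagonal.\<close>

definition gaussian :: "real^'n \<Rightarrow> real^'n^'n \<Rightarrow> (real^'n) measure" where
  "gaussian \<mu> A = density lborel (\<lambda>y. ennreal
     (exp (- ((y - \<mu>) \<bullet> (matrix_inv A *v (y - \<mu>))) / 2) / sqrt ((2 * pi) ^ CARD('n) * det A)))"

text \<open>The \<open>1 \<times> k\<close> matrix \<open>R\<close> is represented by a vector, so that \<open>R \<beta>\<close> becomes \<open>R \<bullet> \<beta>\<close>.\<close>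

definition mean_space :: "real^'k^'n \<Rightarrow> real^'k \<Rightarrow> real \<Rightarrow> (real^'n) set" where
  "mean_space X R r = {X *v \<beta> | \<beta>. R \<bullet> \<beta> = r}"

definition mean_space_lin :: "real^'k^'n \<Rightarrow> real^'k \<Rightarrow> (real^'n) set" where
  "mean_space_lin X R = {X *v \<beta> | \<beta>. R \<bullet> \<beta> = 0}"

definition I0 :: "(real^'n) set \<Rightarrow> 'n set" where
  "I0 L = {i. axis i 1 \<in> L}"

definition I1 :: "(real^'n) set \<Rightarrow> 'n set" where
  "I1 L = UNIV - I0 L"

definition C_Het :: "(real^'n^'n) set" where
  "C_Het = {diag (\<chi> i. (\<tau> $ i)\<^sup>2) | \<tau>. (\<forall>i. (\<tau> $ i)\<^sup>2 > 0) \<and> (\<Sum>i\<in>UNIV. (\<tau> $ i)\<^sup>2) = 1}"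

definition beta_hat :: "real^'k^'n \<Rightarrow> real^'n \<Rightarrow> real^'k" where
  "beta_hat X y = (matrix_inv (transpose X ** X) ** transpose X) *v y"

definition u_hat :: "real^'k^'n \<Rightarrow> real^'n \<Rightarrow> real^'n" where
  "u_hat X y = y - X *v beta_hat X y"

definition Psi_Het :: "real^'k^'n \<Rightarrow> real^'n \<Rightarrow> real^'n \<Rightarrow> real^'k^'k" where
  "Psi_Het X d y =
     matrix_inv (transpose X ** X) ** transpose X ** diag (\<chi> i. d $ i * (u_hat X y $ i)\<^sup>2)
       ** X ** matrix_inv (transpose X ** X)"

definition Omega_Het :: "real^'k^'n \<Rightarrow> real^'k \<Rightarrow> real^'n \<Rightarrow> real^'n \<Rightarrow> real" where
  "Omega_Het X R d y = R \<bullet> (Psi_Het X d y *v R)"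

definition T_Het :: "real^'k^'n \<Rightarrow> real^'k \<Rightarrow> real \<Rightarrow> real^'n \<Rightarrow> real^'n \<Rightarrow> real" where
  "T_Het X R r d y =
     (if Omega_Het X R d y \<noteq> 0 then (R \<bullet> beta_hat X y - r)\<^sup>2 / Omega_Het X R d y else 0)"

text \<open>Deleting columns of \<open>X'\<close> deletes the corresponding entries of the row vector
  \<open>R (X'X)\<^sup>-\<^sup>1 X'\<close>, so \<open>R (X'X)\<^sup>-\<^sup>1 X'(\<not>(i\<^sub>1,\<dots>,i\<^sub>s)) \<noteq> 0\<close> says that one of the retained
  entries is nonzero.\<close>

definition assumption1 :: "real^'k^'n \<Rightarrow> real^'k \<Rightarrow> bool" where
  "assumption1 X R \<longleftrightarrow>
     (\<exists>i. i \<notin> I0 (span (columns X)) \<and>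
          (R v* (matrix_inv (transpose X ** X) ** transpose X)) $ i \<noteq> 0)"

definition cond_N :: "real^'k^'n \<Rightarrow> real^'k \<Rightarrow> bool" where
  "cond_N X R \<longleftrightarrow> (\<forall>i\<in>I1 (mean_space_lin X R). axis i 1 \<notin> span (columns X))"

definition hat_matrix :: "real^'k^'n \<Rightarrow> real^'n^'n" where
  "hat_matrix X = X ** matrix_inv (transpose X ** X) ** transpose X"

definition cond_N' :: "real^'k^'n \<Rightarrow> real^'k \<Rightarrow> bool" where
  "cond_N' X R \<longleftrightarrow>
     (\<forall>i. R \<bullet> (matrix_inv (transpose X ** X) *v row i X) \<noteq> 0 \<longrightarrow> hat_matrix X $ i $ i < 1)"

definition reject_prob ::
    "real^'k^'n \<Rightarrow> real^'k \<Rightarrow> real \<Rightarrow> real^'n \<Rightarrow> real \<Rightarrow> real^'n \<Rightarrow> real^'n^'n \<Rightarrow> real" where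
  "reject_prob X R r d C \<mu> A = measure (gaussian \<mu> A) {y. T_Het X R r d y \<ge> C}"

text \<open>All suprema of probabilities below are over nonempty index sets when \<open>R \<noteq> 0\<close>, so the
  conditionally complete supremum on the reals is the usual one.\<close>

definition test_size :: "real^'k^'n \<Rightarrow> real^'k \<Rightarrow> real \<Rightarrow> real^'n \<Rightarrow> real \<Rightarrow> real" where
  "test_size X R r d C =
     (SUP \<mu>\<^sub>0\<in>mean_space X R r. SUP \<sigma>2\<in>{0<..}. SUP \<Sigma>\<in>C_Het. reject_prob X R r d C \<mu>\<^sub>0 (\<sigma>2 *\<^sub>R \<Sigma>))"

definition C_star :: "real^'k^'n \<Rightarrow> real^'k \<Rightarrow> real \<Rightarrow> real^'n \<Rightarrow> real^'n \<Rightarrow> real" where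
  "C_star X R r d \<mu>\<^sub>0 = Max {T_Het X R r d (\<mu>\<^sub>0 + axis i 1) | i. i \<in> I1 (mean_space_lin X R)}"

definition alpha_star :: "real^'k^'n \<Rightarrow> real^'k \<Rightarrow> real \<Rightarrow> real^'n \<Rightarrow> real^'n \<Rightarrow> real" where
  "alpha_star X R r d \<mu>\<^sub>0 =
     (SUP C\<in>{C_star X R r d \<mu>\<^sub>0<..}. SUP \<Sigma>\<in>C_Het. reject_prob X R r d C \<mu>\<^sub>0 \<Sigma>)"

end

theory Submission
  imports Defs "HOL-Probability.Distributions"
begin

text \<open>With \<open>a = R (X'X)\<^sup>-\<^sup>1 X'\<close> and \<open>\<mu>\<^sub>0 \<in> mean_space X R r\<close>, \<open>T_Het (\<mu>\<^sub>0 + z) = (a \<bullet> z)\<^sup>2 / W z\<close>, where \<open>W\<close> is a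
  nonnegative quadratic form. This is invariant under scaling of \<open>z\<close>, so the rejection probability
  depends on neither \<open>\<mu>\<^sub>0\<close> nor \<open>\<sigma>\<^sup>2\<close>, and the size is the supremum over positive scale vectors \<open>\<tau>\<close> of the
  probability that \<open>(a \<bullet> z)\<^sup>2 - C W z \<ge> 0\<close> at \<open>z = \<tau> * g\<close> with \<open>g\<close> standard Gaussian.

  The zero set of a nonzero quadratic form is null, so by dominated convergence this probability is
  jointly continuous in \<open>(C, \<tau>)\<close>, also at degenerate \<open>\<tau> \<ge> 0\<close>, wherever the form does not vanish
  identically. Letting \<open>\<tau>\<close> tend to a basis vector \<open>e\<^sub>i\<close> with \<open>a\<^sub>i\<^sup>2 > C W e\<^sub>i\<close> gives size \<open>1\<close>: this happens
  for every \<open>C\<close> if (N) fails, and for \<open>C < C\<^sup>*\<close> otherwise. The size is a nonincreasing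
  supremum of continuous functions of \<open>C\<close>, hence right-continuous. Under (N), compactness of the
  normalized scales gives left-continuity beyond \<open>C\<^sup>*\<close> and size tending to \<open>0\<close> as \<open>C \<rightarrow> \<infinity>\<close>.\<close>

section \<open>Gaussian measures with diagonal covariance\<close>

text \<open>Along every line in direction \<open>v\<close> the form is a quadratic polynomial with leading coefficient
  \<open>B v v\<close>, so it has at most two zeros; Fubini and translation invariance do the rest.\<close>

lemma AE_bilinear_form_nonzero:
  fixes B :: "'a::euclidean_space \<Rightarrow> 'a \<Rightarrow> real"
  assumes B: "bilinear B" and v: "B v v \<noteq> 0"
  shows "AE y in lborel. B y y \<noteq> 0"
proof -
  have lin: "linear (B x)" "linear (\<lambda>x. B x y)" for x y
    using B by (auto simp: bilinear_def)
  have bb: "bounded_bilinear B"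
    using B by (simp add: bilinear_conv_bounded_bilinear)
  have cont: "continuous_on UNIV (\<lambda>z. B (snd z + fst z *\<^sub>R v) (snd z + fst z *\<^sub>R v))"
    by (intro bounded_bilinear.continuous_on[OF bb] continuous_intros)
  have contq: "continuous_on UNIV (\<lambda>z. B z z)"
    by (intro bounded_bilinear.continuous_on[OF bb] continuous_intros)
  have meas: "(\<lambda>z. B (snd z + fst z *\<^sub>R v) (snd z + fst z *\<^sub>R v))
      \<in> borel_measurable (lborel \<Otimes>\<^sub>M lborel)"
    using borel_measurable_continuous_onI[OF cont]
    by (simp add: lborel_prod)
  have "AE t in lborel. B (y + t *\<^sub>R v) (y + t *\<^sub>R v) \<noteq> 0" for y
  proof -
    define p where "p = [:B y y, B y v + B v y, B v v:]"
    have "B (y + t *\<^sub>R v) (y + t *\<^sub>R v) = poly p t" for t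
      unfolding p_def by (simp add: lin[THEN linear_add] lin[THEN linear_scale] algebra_simps)
    moreover have "finite {t. poly p t = 0}"
      using v by (intro poly_roots_finite) (simp add: p_def)
    then have "AE t in lborel. t \<notin> {t. poly p t = 0}"
      by (intro AE_not_in countable_imp_null_set_lborel countable_finite)
    ultimately show ?thesis by simp
  qed
  then have "AE y in lborel. AE t in lborel. B (y + t *\<^sub>R v) (y + t *\<^sub>R v) \<noteq> 0" by simp
  then have "AE t in lborel. AE y in lborel. B (y + t *\<^sub>R v) (y + t *\<^sub>R v) \<noteq> 0"
  proof (subst lborel_pair.AE_commute)
    show "{x \<in> space (lborel \<Otimes>\<^sub>M lborel). B (snd x + fst x *\<^sub>R v) (snd x + fst x *\<^sub>R v) \<noteq> 0}
      \<in> sets (lborel \<Otimes>\<^sub>M lborel)"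
      using meas by measurable
  qed
  then have "\<exists>t. AE y in lborel. B (y + t *\<^sub>R v) (y + t *\<^sub>R v) \<noteq> 0"
    by (rule eventually_happens'[rotated]) (simp add: ae_filter_eq_bot_iff)
  then obtain t where t: "AE y in lborel. B (t *\<^sub>R v + y) (t *\<^sub>R v + y) \<noteq> 0"
    by (auto simp: add.commute)
  have "AE y in distr lborel borel ((+) (t *\<^sub>R v)). B y y \<noteq> 0"
    using t borel_measurable_continuous_onI[OF contq] by (subst AE_distr_iff) auto
  then show ?thesis unfolding lborel_distr_plus .
qed

abbreviation std_gaussian :: "(real^'n) measure" where
  "std_gaussian \<equiv> gaussian 0 (mat 1)"

lemma diag_mult_diag: "diag v ** diag w = diag (\<chi> i. v $ i * w $ i)"
  by (simp add: diag_def matrix_matrix_mult_def vec_eq_iff if_distrib[where f="\<lambda>x. x * _"]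
      sum.delta cong: if_cong)

lemma matrix_inv_eqI:
  fixes A B :: "real^'n^'n"
  assumes "A ** B = mat 1"
  shows "matrix_inv A = B"
proof -
  have "B ** A = mat 1" using assms by (simp add: matrix_left_right_inverse)
  \<comment> \<open>\<open>matrix_inv\<close> is a choice operator: a two-sided inverse must exist
    before its property can be used.\<close>
  with assms have "\<exists>A'. A ** A' = mat 1 \<and> A' ** A = mat 1" by blast
  then have "matrix_inv A ** A = mat 1"
    unfolding matrix_inv_def by (rule someI2_ex) simp
  then have "matrix_inv A ** (A ** B) = B"
    by (simp add: matrix_mul_assoc)
  then show ?thesis by (simp add: assms)
qed

lemma matrix_inv_diag:
  assumes "\<And>i. v $ i \<noteq> 0"
  shows "matrix_inv (diag v) = diag (\<chi> i. 1 / v $ i)"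
proof (rule matrix_inv_eqI)
  show "diag v ** diag (\<chi> i. 1 / v $ i) = mat 1"
    using assms by (auto simp: diag_mult_diag) (auto simp: diag_def mat_def vec_eq_iff)
qed

lemma diag_vector_mult: "diag v *v y = v * y"
  by (simp add: diag_def matrix_vector_mult_def vec_eq_iff if_distrib[where f="\<lambda>x. x * _"]
      sum.delta cong: if_cong)

lemma det_diag: "det (diag v) = (\<Prod>i\<in>UNIV. v $ i)"
  by (subst det_diagonal) (auto simp: diag_def)

lemma sets_gaussian [measurable_cong, simp]: "sets (gaussian \<mu> A) = sets borel"
  by (simp add: gaussian_def)

lemma space_gaussian [simp]: "space (gaussian \<mu> A) = UNIV"
  by (simp add: gaussian_def)

lemma std_gaussian_density:
  "std_gaussian = density lborel (\<lambda>y::real^'n. ennreal (exp (- (y \<bullet> y) / 2) / sqrt ((2 * pi) ^ CARD('n))))"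
proof -
  have "matrix_inv (mat 1 :: real^'n^'n) = mat 1"
    by (rule matrix_inv_eqI) simp
  then show ?thesis by (simp add: gaussian_def)
qed

text \<open>The density factors over \<open>Basis\<close> into standard normal densities, each of
  mass \<open>1\<close>.\<close>

lemma prob_space_std_gaussian: "prob_space (std_gaussian :: (real^'n) measure)"
proof
  have eq: "ennreal (exp (- (y \<bullet> y) / 2) / sqrt ((2 * pi) ^ CARD('n)))
     = (\<Prod>b\<in>Basis. ennreal (std_normal_density (y \<bullet> b)))" for y :: "real^'n"
  proof -
    have "(\<Prod>b\<in>Basis. std_normal_density (y \<bullet> b))
      = (\<Prod>b\<in>(Basis::(real^'n) set). 1 / sqrt (2 * pi)) * exp (\<Sum>b\<in>Basis. - (y \<bullet> b)\<^sup>2 / 2)"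
      unfolding std_normal_density_def prod.distrib by (simp add: exp_sum)
    also have "(\<Sum>b\<in>Basis. - (y \<bullet> b)\<^sup>2 / 2) = - (y \<bullet> y) / 2"
      by (subst (2) euclidean_inner)
        (simp add: sum_negf sum_divide_distrib[symmetric] power2_eq_square)
    finally show ?thesis
      unfolding real_sqrt_power by (simp add: prod_ennreal power_divide)
  qed
  have one: "(\<integral>\<^sup>+x. ennreal (std_normal_density x) \<partial>lborel) = 1"
  proof -
    interpret N: prob_space "density lborel (\<lambda>x. ennreal (std_normal_density x))"
      by (rule prob_space_normal_density) simp
    show ?thesis using N.emeasure_space_1 by (simp add: emeasure_density)
  qed
  show "emeasure std_gaussian (space (std_gaussian :: (real^'n) measure)) = 1"
    unfolding std_gaussian_density eq
    by (simp add: emeasure_density, subst nn_integral_lborel_prod) (simp_all add: one)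
qed

text \<open>The Jacobian of a diagonal affine map is the square root of the determinant in the
  density. Mean and scale thus move out of the measure into the argument of the statistic.\<close>

lemma gaussian_diag_eq_distr:
  fixes \<mu> s :: "real^'n"
  assumes s: "\<And>i. s $ i > 0"
  shows "gaussian \<mu> (diag (\<chi> i. (s $ i)\<^sup>2)) = distr std_gaussian borel (\<lambda>g. \<mu> + s * g)"
proof -
  define T :: "real^'n \<Rightarrow> real^'n" where "T = (\<lambda>g. \<mu> + s * g)"
  define f where "f = (\<lambda>y. ennreal (exp (- ((y - \<mu>) \<bullet> (matrix_inv (diag (\<chi> i. (s $ i)\<^sup>2)) *v (y - \<mu>))) / 2)
     / sqrt ((2 * pi) ^ CARD('n) * det (diag (\<chi> i. (s $ i)\<^sup>2)))))"
  have s0: "s $ i \<noteq> 0" for i using s[of i] by simp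
  have T_eq: "T = (\<lambda>x. \<mu> + (\<Sum>j\<in>Basis. ((s \<bullet> j) * (x \<bullet> j)) *\<^sub>R j))"
  proof
    fix x
    have "s * x = (\<Sum>j\<in>Basis. ((s * x) \<bullet> j) *\<^sub>R j)"
      by (simp add: euclidean_representation)
    also have "\<dots> = (\<Sum>j\<in>Basis. ((s \<bullet> j) * (x \<bullet> j)) *\<^sub>R j)"
      by (intro sum.cong refl) (auto simp: Basis_vec_def inner_axis)
    finally show "T x = \<mu> + (\<Sum>j\<in>Basis. ((s \<bullet> j) * (x \<bullet> j)) *\<^sub>R j)"
      by (simp add: T_def)
  qed
  have T_meas [measurable]: "T \<in> borel_measurable borel"
    unfolding T_eq by measurable
  have prod_s: "(\<Prod>j\<in>(Basis::(real^'n) set). \<bar>s \<bullet> j\<bar>) = (\<Prod>i\<in>UNIV. s $ i)"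
  proof -
    have "(\<Prod>j\<in>(Basis::(real^'n) set). \<bar>s \<bullet> j\<bar>) = (\<Prod>j\<in>range (\<lambda>i. axis i (1::real)). \<bar>s \<bullet> j\<bar>)"
      by (rule prod.cong) (auto simp: Basis_vec_def)
    also have "\<dots> = (\<Prod>i\<in>UNIV. s $ i)"
      using s by (subst prod.reindex) (auto simp: inj_on_def axis_eq_axis inner_axis less_imp_le)
    finally show ?thesis .
  qed
  have lb: "lborel = density (distr lborel borel T) (\<lambda>_. ennreal (\<Prod>i\<in>UNIV. s $ i))"
    unfolding T_eq prod_s[symmetric]
    by (rule lborel_affine_euclidean) (use s0 in \<open>auto simp: Basis_vec_def inner_axis\<close>)
  have det: "det (diag (\<chi> i. (s $ i)\<^sup>2)) = (\<Prod>i\<in>UNIV. s $ i)\<^sup>2"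
    by (simp add: det_diag prod_power_distrib)
  have pos: "(\<Prod>i\<in>UNIV. s $ i) > 0" using s by (simp add: prod_pos)
  have inner: "(s * g) \<bullet> (matrix_inv (diag (\<chi> i. (s $ i)\<^sup>2)) *v (s * g)) = g \<bullet> g" for g
    using s0 by (subst matrix_inv_diag)
      (auto simp: diag_vector_mult inner_vec_def power2_eq_square intro!: sum.cong)
  have f_meas: "f \<in> borel_measurable borel"
    unfolding f_def
    by (intro measurable_compose[OF _ measurable_ennreal] borel_measurable_continuous_onI
        continuous_intros continuous_on_compose2[OF matrix_vector_mult_linear_continuous_on[of UNIV]])
      (use s0 det in auto)
  have f_T: "ennreal (\<Prod>i\<in>UNIV. s $ i) * f (T g) = ennreal (exp (- (g \<bullet> g) / 2) / sqrt ((2 * pi) ^ CARD('n)))" for g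
    using pos unfolding f_def T_def det
    by (simp add: inner real_sqrt_mult ennreal_mult'[symmetric] s0)
  have "gaussian \<mu> (diag (\<chi> i. (s $ i)\<^sup>2)) = density lborel f"
    by (simp add: gaussian_def f_def)
  also have "\<dots> = density (distr lborel borel T) (\<lambda>y. ennreal (\<Prod>i\<in>UNIV. s $ i) * f y)"
    by (subst lb, subst density_density_eq) (use f_meas in auto)
  also have "\<dots> = distr (density lborel (\<lambda>g. ennreal (\<Prod>i\<in>UNIV. s $ i) * f (T g))) borel T"
    by (subst density_distr) (use f_meas in auto)
  also have "\<dots> = distr std_gaussian borel T"
    unfolding f_T std_gaussian_density ..
  finally show ?thesis unfolding T_def .
qed

lemma AE_std_gaussian:
  assumes "AE y in lborel. P y"
  shows "AE y in std_gaussian. P (y::real^'n)"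
proof -
  have "(\<lambda>y::real^'n. ennreal (exp (- (y \<bullet> y) / 2) / sqrt ((2 * pi) ^ CARD('n)))) \<in> borel_measurable lborel"
    by measurable
  then show ?thesis
    using assms unfolding std_gaussian_density by (subst AE_density) auto
qed

section \<open>Ratios of quadratic forms under Gaussian scale families\<close>

lemma tendsto_vec_times:
  fixes x y :: "'b \<Rightarrow> real^'n"
  assumes "(x \<longlongrightarrow> x') G" "(y \<longlongrightarrow> y') G"
  shows "((\<lambda>m. x m * y m) \<longlongrightarrow> x' * y') G"
  using assms by (intro vec_tendstoI) (auto intro!: tendsto_intros)

lemma tendsto_add_inverse:
  fixes \<tau> :: "real^'n"
  shows "(\<lambda>m. \<tau> + (1 / real (Suc m)) *\<^sub>R 1) \<longlonglongrightarrow> \<tau>"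
  using tendsto_add[OF tendsto_const tendsto_scaleR[OF LIMSEQ_inverse_real_of_nat tendsto_const], of \<tau> 1]
  by (simp add: inverse_eq_divide)

lemma axis_times: "axis i 1 * (z::real^'n) = (z $ i) *\<^sub>R axis i 1"
  by (simp add: vec_eq_iff axis_def)

text \<open>For \<open>W z \<noteq> 0\<close> the event \<open>(a \<bullet> z)\<^sup>2 / W z \<ge> C\<close> is \<open>q 1 C z \<ge> 0\<close>. The homogeneous pair \<open>(s, t)\<close>
  in place of \<open>(1, C)\<close> makes the limit \<open>C \<rightarrow> \<infinity>\<close> the ordinary limit \<open>(s, t) \<rightarrow> (0, 1)\<close>.\<close>

locale quadratic_ratio =
  fixes a :: "real^'n" and w :: "real^'n" and u :: "real^'n \<Rightarrow> real^'n"
  assumes linear_u: "linear u" and w_nonneg: "\<And>i. w $ i \<ge> 0"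
    and a_kernel: "\<exists>z. a \<bullet> z \<noteq> 0 \<and> u z = 0"
begin

definition W :: "real^'n \<Rightarrow> real" where
  "W z = (\<Sum>i\<in>UNIV. w $ i * (u z $ i)\<^sup>2)"

definition q :: "real \<Rightarrow> real \<Rightarrow> real^'n \<Rightarrow> real" where
  "q s t z = s * (a \<bullet> z)\<^sup>2 - t * W z"

text \<open>The sign of a form replaces the ratio, so points at which \<open>W\<close> vanishes need
  no convention for division by zero.\<close>

definition Q :: "real \<Rightarrow> real \<Rightarrow> real^'n \<Rightarrow> real" where
  "Q s t \<tau> = measure std_gaussian {g. q s t (\<tau> * g) \<ge> 0}"

text \<open>This will be the size as a function of the critical value; by \<open>Q_scale\<close> the
  scales need no normalization.\<close>

definition F :: "real \<Rightarrow> real" where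
  "F C = (SUP \<tau>\<in>{\<tau>. \<forall>i. \<tau> $ i > 0}. Q 1 C \<tau>)"

lemma W_nonneg: "W z \<ge> 0"
  unfolding W_def using w_nonneg by (intro sum_nonneg) auto

lemma W_eq_0_iff: "W z = 0 \<longleftrightarrow> (\<forall>i. w $ i = 0 \<or> u z $ i = 0)"
  unfolding W_def using w_nonneg by (subst sum_nonneg_eq_0_iff) auto

lemma W_scaleR: "W (c *\<^sub>R z) = c\<^sup>2 * W z"
  by (simp add: W_def linear_scale[OF linear_u] power_mult_distrib sum_distrib_left mult_ac)

lemma q_scaleR: "q s t (c *\<^sub>R z) = c\<^sup>2 * q s t z"
  by (simp add: q_def W_scaleR power_mult_distrib algebra_simps)

lemma tendsto_q:
  assumes "(s \<longlongrightarrow> s') G" "(t \<longlongrightarrow> t') G" "(z \<longlongrightarrow> z') G"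
  shows "((\<lambda>m. q (s m) (t m) (z m)) \<longlongrightarrow> q s' t' z') G"
proof -
  have "bounded_linear u" using linear_u by (simp add: linear_conv_bounded_linear)
  then have "((\<lambda>m. u (z m)) \<longlongrightarrow> u z') G" using assms(3) by (rule bounded_linear.tendsto)
  then show ?thesis unfolding q_def W_def by (intro tendsto_intros assms)
qed

lemma continuous_on_W: "continuous_on S W"
proof -
  have "continuous_on S u" using linear_u by (simp add: linear_continuous_on linear_conv_bounded_linear)
  then show ?thesis unfolding W_def by (intro continuous_intros)
qed

lemma continuous_on_q: "continuous_on S (\<lambda>g. q s t (\<tau> * g))"
  unfolding continuous_on_def
  by (intro ballI tendsto_q tendsto_vec_times tendsto_const tendsto_ident_at)

lemma q_measurable [measurable]: "(\<lambda>g. q s t (\<tau> * g)) \<in> borel_measurable borel"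
  by (intro borel_measurable_continuous_onI continuous_on_q)

lemma AE_q_nonzero:
  assumes "q s t (\<tau> * v) \<noteq> 0"
  shows "AE g in std_gaussian. q s t (\<tau> * g) \<noteq> 0"
proof (rule AE_std_gaussian)
  \<comment> \<open>\<open>B\<close> is the polar form of
    \<open>g \<mapsto> q s t (\<tau> * g)\<close>; the witness \<open>v\<close> shows that this form
    is not identically zero.\<close>
  define B where "B = (\<lambda>x y. s * (a \<bullet> (\<tau> * x)) * (a \<bullet> (\<tau> * y))
      - t * (\<Sum>i\<in>UNIV. w $ i * (u (\<tau> * x) $ i * u (\<tau> * y) $ i)))"
  have B_q: "B g g = q s t (\<tau> * g)" for g
    by (simp add: B_def q_def W_def power2_eq_square)
  have add: "\<tau> * (x + y) = \<tau> * x + \<tau> * y" and scale: "\<tau> * (c *\<^sub>R x) = c *\<^sub>R (\<tau> * x)" for x y c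
    by (simp_all add: vec_eq_iff algebra_simps)
  have "linear (\<lambda>y. B x y)" for x
    by (rule linearI) (simp_all add: B_def add scale linear_add[OF linear_u] linear_scale[OF linear_u]
        inner_add_right algebra_simps sum.distrib sum_distrib_left)
  moreover have "B x y = B y x" for x y
    by (simp add: B_def mult_ac)
  ultimately have "bilinear B" unfolding bilinear_def by simp
  then show "AE y in lborel. q s t (\<tau> * y) \<noteq> 0"
    using AE_bilinear_form_nonzero[of B v] assms by (simp add: B_q)
qed

text \<open>Dominated convergence: where the limiting form is nonzero, the approximating forms
  eventually share its sign, and \<open>v\<close> makes this happen almost everywhere.\<close>

lemma Q_tendsto:
  assumes "s \<longlonglongrightarrow> s'" "t \<longlonglongrightarrow> t'" "\<tau> \<longlonglongrightarrow> \<tau>'" and v: "q s' t' (\<tau>' * v) \<noteq> 0"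
  shows "(\<lambda>m. Q (s m) (t m) (\<tau> m)) \<longlonglongrightarrow> Q s' t' \<tau>'"
proof -
  interpret prob_space "std_gaussian :: (real^'n) measure" by (rule prob_space_std_gaussian)
  define ind where "ind = (\<lambda>s t \<tau> g. indicat_real {g. q s t (\<tau> * g) \<ge> 0} g)"
  have Q_ind: "Q s t \<tau> = (LINT g|std_gaussian. ind s t \<tau> g)" for s t \<tau>
    unfolding Q_def ind_def by simp
  have meas: "ind s t \<tau> \<in> borel_measurable std_gaussian" for s t \<tau>
    unfolding ind_def by measurable
  have lim: "(\<lambda>m. ind (s m) (t m) (\<tau> m) g) \<longlonglongrightarrow> ind s' t' \<tau>' g"
    if "q s' t' (\<tau>' * g) \<noteq> 0" for g
  proof -
    have lim: "(\<lambda>m. q (s m) (t m) (\<tau> m * g)) \<longlonglongrightarrow> q s' t' (\<tau>' * g)"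
      by (intro tendsto_q tendsto_vec_times assms tendsto_const)
    have "\<forall>\<^sub>F m in sequentially. ind (s m) (t m) (\<tau> m) g = ind s' t' \<tau>' g"
    proof (cases "q s' t' (\<tau>' * g) > 0")
      case True
      show ?thesis
        by (rule eventually_mono[OF order_tendstoD(1)[OF lim True]])
          (use True in \<open>auto simp: ind_def indicator_def\<close>)
    next
      case False
      then have neg: "q s' t' (\<tau>' * g) < 0" using that by simp
      show ?thesis
        by (rule eventually_mono[OF order_tendstoD(2)[OF lim neg]])
          (use neg in \<open>auto simp: ind_def indicator_def\<close>)
    qed
    then show ?thesis by (rule tendsto_eventually)
  qed
  show ?thesis unfolding Q_ind
  proof (rule integral_dominated_convergence[where w="\<lambda>_. 1"])
    show "AE g in std_gaussian. (\<lambda>m. ind (s m) (t m) (\<tau> m) g) \<longlonglongrightarrow> ind s' t' \<tau>' g"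
      using AE_q_nonzero[OF v] by eventually_elim (rule lim)
    show "AE g in std_gaussian. norm (ind (s m) (t m) (\<tau> m) g) \<le> 1" for m
      by (simp add: ind_def indicator_def)
  qed (simp_all add: meas)
qed

lemma Q_le_1: "Q s t \<tau> \<le> 1"
proof -
  interpret prob_space "std_gaussian :: (real^'n) measure" by (rule prob_space_std_gaussian)
  show ?thesis by (simp_all add: Q_def)
qed

lemma Q_cong:
  assumes "\<And>g. q s t (\<tau> * g) \<ge> 0 \<longleftrightarrow> q s' t' (\<tau>' * g) \<ge> 0"
  shows "Q s t \<tau> = Q s' t' \<tau>'"
  by (simp add: Q_def assms)

lemma Q_scale:
  assumes "c \<noteq> 0"
  shows "Q s t (c *\<^sub>R \<tau>) = Q s t \<tau>"
proof (rule Q_cong)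
  fix g
  have "c *\<^sub>R \<tau> * g = c *\<^sub>R (\<tau> * g)" by (simp add: vec_eq_iff)
  then show "q s t (c *\<^sub>R \<tau> * g) \<ge> 0 \<longleftrightarrow> q s t (\<tau> * g) \<ge> 0"
    using assms by (simp add: q_scaleR zero_le_mult_iff not_le)
qed

lemma Q_antimono:
  assumes "C \<le> C'"
  shows "Q 1 C' \<tau> \<le> Q 1 C \<tau>"
proof -
  interpret prob_space "std_gaussian :: (real^'n) measure" by (rule prob_space_std_gaussian)
  have "q 1 C' z \<le> q 1 C z" for z
    using assms W_nonneg[of z] by (simp add: q_def mult_right_mono)
  then have "{g. q 1 C' (\<tau> * g) \<ge> 0} \<subseteq> {g. q 1 C (\<tau> * g) \<ge> 0}"
    by (auto intro: order_trans)
  moreover have "{g. q 1 C (\<tau> * g) \<ge> 0} \<in> sets std_gaussian"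
    by (simp, measurable)
  ultimately show ?thesis unfolding Q_def by (intro finite_measure_mono)
qed

lemma positive_scales_nonempty: "{\<tau>::real^'n. \<forall>i. \<tau> $ i > 0} \<noteq> {}"
  by (auto intro: exI[of _ 1])

lemma bdd_above_Q: "bdd_above (Q s t ` T)"
  by (auto intro!: bdd_aboveI[of _ 1] Q_le_1)

lemma Q_le_F: "(\<And>i. \<tau> $ i > 0) \<Longrightarrow> Q 1 C \<tau> \<le> F C"
  unfolding F_def by (intro cSUP_upper bdd_above_Q) simp

lemma less_F_iff: "x < F C \<longleftrightarrow> (\<exists>\<tau>. (\<forall>i. \<tau> $ i > 0) \<and> x < Q 1 C \<tau>)"
  unfolding F_def by (subst less_cSUP_iff[OF positive_scales_nonempty bdd_above_Q]) auto

lemma F_le_1: "F C \<le> 1"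
  unfolding F_def by (intro cSUP_least positive_scales_nonempty Q_le_1)

lemma F_antimono:
  assumes "C \<le> C'"
  shows "F C' \<le> F C"
  unfolding F_def
  by (intro cSUP_mono positive_scales_nonempty bdd_above_Q) (use Q_antimono[OF assms] in auto)

text \<open>Approximation by strictly positive scales extends the bound to scales with zero
  entries.\<close>

lemma Q_limit_le_F:
  assumes "\<And>i. \<tau> $ i \<ge> 0" and "q 1 C (\<tau> * v) \<noteq> 0"
  shows "Q 1 C \<tau> \<le> F C"
proof (rule LIMSEQ_le_const2)
  show "(\<lambda>m. Q 1 C (\<tau> + (1 / real (Suc m)) *\<^sub>R 1)) \<longlonglongrightarrow> Q 1 C \<tau>"
    by (rule Q_tendsto[OF tendsto_const tendsto_const tendsto_add_inverse assms(2)])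
  show "\<exists>N. \<forall>m\<ge>N. Q 1 C (\<tau> + (1 / real (Suc m)) *\<^sub>R 1) \<le> F C"
    using assms(1) by (intro exI allI impI Q_le_F) (simp add: add_nonneg_pos)
qed

text \<open>At the degenerate scale \<open>axis i 1\<close> the form equals
  \<open>(g $ i)\<^sup>2 * q 1 C (axis i 1)\<close>, so the event is the whole space.\<close>

lemma F_eq_1:
  assumes "q 1 C (axis i 1) > 0"
  shows "F C = 1"
proof -
  interpret prob_space "std_gaussian :: (real^'n) measure" by (rule prob_space_std_gaussian)
  have "axis i 1 * axis i 1 = (axis i 1 :: real^'n)"
    by (simp add: axis_times)
  then have "Q 1 C (axis i 1) \<le> F C"
    using assms by (intro Q_limit_le_F[where v="axis i 1"]) (auto simp: axis_def)
  moreover have "{g. q 1 C (axis i 1 * g) \<ge> 0} = UNIV"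
    using assms by (simp add: axis_times q_scaleR)
  then have "Q 1 C (axis i 1) = 1"
    using prob_space by (simp add: Q_def)
  ultimately show ?thesis using F_le_1[of C] by simp
qed

text \<open>On the kernel of \<open>u\<close> the form \<open>W\<close> is zero, so
  \<open>(a \<bullet> z)\<^sup>2\<close> alone decides the sign, whatever \<open>C\<close>
  is.\<close>

lemma q_nonzero_of_pos:
  assumes "\<And>i. \<tau> $ i > 0"
  shows "\<exists>v. q 1 C (\<tau> * v) > 0"
proof -
  obtain z where z: "a \<bullet> z \<noteq> 0" "u z = 0" using a_kernel by blast
  have "\<tau> $ i \<noteq> 0" for i using assms[of i] by simp
  then have "\<tau> * (\<chi> i. z $ i / \<tau> $ i) = z" by (simp add: vec_eq_iff)
  moreover have "q 1 C z > 0" using z by (simp add: q_def W_def)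
  ultimately show ?thesis by metis
qed

text \<open>A supremum of continuous functions of \<open>C\<close> is lower semicontinuous; since
  \<open>F\<close> is nonincreasing, this amounts to right-continuity.\<close>

lemma F_right_continuous:
  assumes "x < F C"
  shows "\<exists>C'>C. x < F C'"
proof -
  obtain \<tau> where \<tau>: "\<And>i. \<tau> $ i > 0" and x: "x < Q 1 C \<tau>"
    using assms by (auto simp: less_F_iff)
  obtain v where v: "q 1 C (\<tau> * v) \<noteq> 0" using q_nonzero_of_pos[OF \<tau>, of C] by force
  have "(\<lambda>m. C + 1 / real (Suc m)) \<longlonglongrightarrow> C"
    using LIMSEQ_inverse_real_of_nat_add[of C] by (simp add: inverse_eq_divide)
  then have "(\<lambda>m. Q 1 (C + 1 / real (Suc m)) \<tau>) \<longlonglongrightarrow> Q 1 C \<tau>"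
    using v by (intro Q_tendsto tendsto_const)
  from order_tendstoD(1)[OF this x] obtain m where "x < Q 1 (C + 1 / real (Suc m)) \<tau>"
    using eventually_happens'[OF sequentially_bot] by blast
  then show ?thesis
    using \<tau> by (intro exI[of _ "C + 1 / real (Suc m)"]) (auto simp: less_F_iff)
qed

text \<open>Already at scale \<open>1\<close> the event contains a nonempty open set, and the
  Gaussian density is positive everywhere.\<close>

lemma F_pos: "F C > 0"
proof -
  interpret prob_space "std_gaussian :: (real^'n) measure" by (rule prob_space_std_gaussian)
  define U where "U = {g::real^'n. q 1 C (1 * g) > 0}"
  have "open U" unfolding U_def by (intro open_Collect_less continuous_on_const continuous_on_q)
  have U: "U \<in> sets borel" unfolding U_def by measurable
  have "U \<noteq> {}" using q_nonzero_of_pos[of 1 C] by (simp add: U_def)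
  have "\<not> (AE g in std_gaussian. g \<notin> U)"
  proof
    assume "AE g in std_gaussian. g \<notin> U"
    then have "AE g in lborel. g \<notin> U"
      unfolding std_gaussian_density
      by (subst (asm) AE_density) (auto simp: ennreal_eq_0_iff)
    then have "emeasure lborel U = 0"
      using U by (subst (asm) AE_iff_measurable[of U]) auto
    then have "U \<in> null_sets lebesgue"
      using U by (simp add: null_sets_completionI null_setsI)
    then have "negligible U" by (simp add: negligible_iff_null_sets)
    with \<open>open U\<close> \<open>U \<noteq> {}\<close> show False using open_not_negligible by blast
  qed
  then have "prob U \<noteq> 0" using U by (subst prob_eq_0) auto
  moreover have "{g. q 1 C (1 * g) \<ge> 0} \<in> sets borel" by measurable
  then have "prob U \<le> Q 1 C 1"
    unfolding Q_def U_def by (intro finite_measure_mono) auto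
  ultimately have "Q 1 C 1 > 0" using measure_nonneg[of std_gaussian U] by linarith
  then show ?thesis by (auto simp: less_F_iff intro!: exI[of _ 1])
qed

end

section \<open>Compactness of normalized scales\<close>

text \<open>\<open>W_axis_pos\<close> is the abstract form of (N): no basis vector has a positive
  numerator over a zero denominator.\<close>

locale nondegenerate_ratio = quadratic_ratio +
  assumes W_axis_pos: "\<And>i. a $ i \<noteq> 0 \<Longrightarrow> W (axis i 1) > 0"
begin

definition J :: "'a set" where
  "J = {i. W (axis i 1) > 0}"

lemma J_nonempty: "J \<noteq> {}"
proof -
  have "a \<noteq> 0" using a_kernel by auto
  then obtain i where "a $ i \<noteq> 0" by (auto simp: vec_eq_iff)
  then show ?thesis using W_axis_pos by (auto simp: J_def)
qed

text \<open>\<open>W\<close> is a sum of nonnegative terms, so \<open>W (axis i 1) = 0\<close> kills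
  every component of \<open>u (axis i 1)\<close> with nonzero weight, and \<open>W\<close> ignores
  coordinate \<open>i\<close>. So does \<open>a\<close>, by \<open>W_axis_pos\<close>.\<close>

lemma q_cong_J:
  assumes "\<And>i. i \<in> J \<Longrightarrow> z $ i = z' $ i"
  shows "q s t z = q s t z'"
proof -
  define \<delta> where "\<delta> = z - z'"
  have \<delta>: "\<delta> $ i = 0" if "i \<in> J" for i using assms[OF that] by (simp add: \<delta>_def)
  have "a $ i * \<delta> $ i = 0" for i
    using \<delta>[of i] W_axis_pos[of i] by (auto simp: J_def)
  then have "a \<bullet> \<delta> = 0" unfolding inner_vec_def inner_real_def by (simp only: sum.neutral_const)
  then have a: "a \<bullet> z = a \<bullet> z'" by (simp add: \<delta>_def inner_diff_right)
  have "w $ j * (u z $ j)\<^sup>2 = w $ j * (u z' $ j)\<^sup>2" for j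
  proof (cases "w $ j = 0")
    case False
    have "u \<delta> = u (\<Sum>i\<in>UNIV. \<delta> $ i *\<^sub>R axis i 1)"
      by (simp add: basis_expansion flip: scalar_mult_eq_scaleR)
    also have "\<dots> = (\<Sum>i\<in>UNIV. \<delta> $ i *\<^sub>R u (axis i 1))"
      by (simp add: linear_sum[OF linear_u] linear_scale[OF linear_u])
    finally have "u \<delta> $ j = (\<Sum>i\<in>UNIV. \<delta> $ i * u (axis i 1) $ j)" by simp
    also have "\<dots> = 0"
    proof (rule sum.neutral, rule ballI)
      fix i
      show "\<delta> $ i * u (axis i 1) $ j = 0"
      proof (cases "i \<in> J")
        case False
        then have "W (axis i 1) = 0" using W_nonneg[of "axis i 1"] by (simp add: J_def)
        with \<open>w $ j \<noteq> 0\<close> show ?thesis by (auto simp: W_eq_0_iff)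
      qed (simp add: \<delta>)
    qed
    finally show ?thesis by (simp add: \<delta>_def linear_diff[OF linear_u])
  qed simp
  then show ?thesis by (simp only: q_def a W_def)
qed

text \<open>The form \<open>q\<close> ignores the coordinates outside \<open>J\<close>. Scaling the maximum over \<open>J\<close> to \<open>1\<close> therefore
  keeps a coordinate with \<open>W (axis i 1) > 0\<close> alive in every limit of scales, which excludes the
  indeterminate form \<open>0 / 0\<close>; normalizing over all coordinates would not.\<close>

definition normalized_scales :: "(real^'a) set" where
  "normalized_scales = cbox 0 1 \<inter> (\<Union>i\<in>J. {\<tau>. \<tau> $ i = 1})"

lemma compact_normalized_scales: "compact normalized_scales"
  unfolding normalized_scales_def
  by (intro compact_Int_closed compact_cbox closed_UN ballI closed_Collect_eq continuous_intros) auto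

text \<open>Coordinates outside \<open>J\<close> could exceed \<open>1\<close> after division by the
  maximum over \<open>J\<close>; setting them to \<open>0\<close> is harmless because
  \<open>q\<close> ignores them.\<close>

lemma Q_normalize:
  assumes "\<And>i. \<tau> $ i > 0"
  obtains \<tau>' where "\<tau>' \<in> normalized_scales" "\<And>s t. Q s t \<tau>' = Q s t \<tau>"
proof -
  define M where "M = Max ((\<lambda>i. \<tau> $ i) ` J)"
  have "M \<in> (\<lambda>i. \<tau> $ i) ` J" unfolding M_def using J_nonempty by (intro Max_in) auto
  then obtain i where i: "i \<in> J" "M = \<tau> $ i" by blast
  have M: "M > 0" and M0: "M \<noteq> 0" using assms[of i] i by simp_all
  have le: "\<tau> $ j \<le> M" if "j \<in> J" for j unfolding M_def using that by simp
  define \<tau>' :: "real^'a" where "\<tau>' = (\<chi> j. if j \<in> J then \<tau> $ j / M else 0)"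
  show thesis
  proof
    show "\<tau>' \<in> normalized_scales"
      using M M0 le assms i by (auto simp: normalized_scales_def \<tau>'_def mem_box_cart less_imp_le intro!: bexI[of _ i])
    fix s t
    have "Q s t \<tau>' = Q s t ((1 / M) *\<^sub>R \<tau>)"
    proof (rule Q_cong)
      fix g
      have "q s t (\<tau>' * g) = q s t ((1 / M) *\<^sub>R \<tau> * g)"
        by (rule q_cong_J) (simp add: \<tau>'_def)
      then show "q s t (\<tau>' * g) \<ge> 0 \<longleftrightarrow> q s t ((1 / M) *\<^sub>R \<tau> * g) \<ge> 0" by simp
    qed
    then show "Q s t \<tau>' = Q s t \<tau>" using M by (simp add: Q_scale)
  qed
qed

text \<open>Compactness yields a limiting scale along a subsequence. Its entry \<open>1\<close> at
  some \<open>i \<in> J\<close>, together with \<open>nz\<close>, keeps the limiting form from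
  vanishing, so \<open>Q_tendsto\<close> applies.\<close>

lemma Q_limit_point:
  assumes s: "s \<longlonglongrightarrow> s'" and t: "t \<longlonglongrightarrow> t'"
    and nz: "\<And>i. i \<in> J \<Longrightarrow> q s' t' (axis i 1) \<noteq> 0"
    and \<tau>: "\<And>m i. \<tau> m $ i > 0" and c: "\<And>m. c \<le> Q (s m) (t m) (\<tau> m)"
  obtains \<tau>' v where "\<And>i. \<tau>' $ i \<ge> 0" "q s' t' (\<tau>' * v) \<noteq> 0" "c \<le> Q s' t' \<tau>'"
proof -
  have "\<forall>m. \<exists>\<tau>'. \<tau>' \<in> normalized_scales \<and> (\<forall>s t. Q s t \<tau>' = Q s t (\<tau> m))"
    using Q_normalize[OF \<tau>] by metis
  then obtain \<tau>n where \<tau>n: "\<And>m. \<tau>n m \<in> normalized_scales"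
      and Q_\<tau>n: "\<And>m s t. Q s t (\<tau>n m) = Q s t (\<tau> m)"
    by metis
  obtain l \<rho> where l: "l \<in> normalized_scales" and \<rho>: "strict_mono \<rho>" and lim: "(\<tau>n \<circ> \<rho>) \<longlonglongrightarrow> l"
    using compact_normalized_scales \<tau>n unfolding compact_def by metis
  obtain i where i: "i \<in> J" "l $ i = 1"
    using l by (auto simp: normalized_scales_def)
  have q_l: "q s' t' (l * axis i 1) \<noteq> 0"
  proof -
    have "l * axis i 1 = axis i 1" using i by (simp add: vec_eq_iff axis_def)
    then show ?thesis using nz[OF i(1)] by simp
  qed
  have "(\<lambda>m. Q ((s \<circ> \<rho>) m) ((t \<circ> \<rho>) m) ((\<tau>n \<circ> \<rho>) m)) \<longlonglongrightarrow> Q s' t' l"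
    using q_l by (intro Q_tendsto LIMSEQ_subseq_LIMSEQ[OF s \<rho>] LIMSEQ_subseq_LIMSEQ[OF t \<rho>] lim)
  then have "c \<le> Q s' t' l"
    by (rule LIMSEQ_le_const) (simp add: Q_\<tau>n c)
  with q_l show thesis
    using l by (intro that) (auto simp: normalized_scales_def mem_box_cart)
qed

text \<open>Dividing the form by the critical value leads to the limiting form \<open>- W\<close>,
  which is negative almost everywhere; its \<open>Q\<close> is \<open>0\<close>, against the lower
  bound \<open>\<alpha>\<close>.\<close>

lemma F_arbitrarily_small:
  assumes "\<alpha> > 0"
  shows "\<exists>C. F C \<le> \<alpha>"
proof (rule ccontr)
  assume "\<not> ?thesis"
  then have "\<alpha> < F (real (Suc m))" for m by (simp add: not_le)
  then have "\<forall>m. \<exists>\<tau>. (\<forall>i. \<tau> $ i > 0) \<and> \<alpha> < Q 1 (real (Suc m)) \<tau>" by (simp add: less_F_iff)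
  then obtain \<tau> where \<tau>: "\<And>m i. \<tau> m $ i > 0" and Q_gt: "\<And>m. \<alpha> < Q 1 (real (Suc m)) (\<tau> m)"
    by metis
  have "Q 1 (real (Suc m)) \<tau> = Q (inverse (real (Suc m))) 1 \<tau>" for m \<tau>
    by (rule Q_cong) (simp add: q_def field_simps del: of_nat_Suc)
  with Q_gt have ge: "\<alpha> \<le> Q (inverse (real (Suc m))) 1 (\<tau> m)" for m by (metis less_imp_le)
  have nz: "q 0 1 (axis i 1) \<noteq> 0" if "i \<in> J" for i using that by (simp add: q_def J_def)
  obtain \<tau>' v where v: "q 0 1 (\<tau>' * v) \<noteq> 0" and "\<alpha> \<le> Q 0 1 \<tau>'"
    using Q_limit_point[OF LIMSEQ_inverse_real_of_nat tendsto_const nz \<tau> ge] by blast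
  interpret prob_space "std_gaussian :: (real^'a) measure" by (rule prob_space_std_gaussian)
  have "AE g in std_gaussian. g \<notin> {g. q 0 1 (\<tau>' * g) \<ge> 0}"
    using AE_q_nonzero[OF v] by eventually_elim (simp add: q_def not_le less_le W_nonneg)
  moreover have "{g. q 0 1 (\<tau>' * g) \<ge> 0} \<in> events" by (simp, measurable)
  ultimately have "Q 0 1 \<tau>' = 0" unfolding Q_def by (simp add: prob_eq_0)
  then show False using \<open>\<alpha> \<le> Q 0 1 \<tau>'\<close> assms by simp
qed

text \<open>Scales that beat \<open>c\<close> at critical values increasing to \<open>C\<close> have
  a limit after normalization; \<open>Q_limit_le_F\<close> returns from this possibly degenerate
  limit to \<open>F C\<close>.\<close>

lemma F_left_continuous:
  assumes neg: "\<And>i. i \<in> J \<Longrightarrow> q 1 C (axis i 1) \<noteq> 0" and c: "\<And>C'. C' < C \<Longrightarrow> c < F C'"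
  shows "c \<le> F C"
proof -
  have "c < F (C - inverse (real (Suc m)))" for m by (rule c) simp
  then have "\<forall>m. \<exists>\<tau>. (\<forall>i. \<tau> $ i > 0) \<and> c < Q 1 (C - inverse (real (Suc m))) \<tau>"
    by (simp add: less_F_iff)
  then obtain \<tau> where \<tau>: "\<And>m i. \<tau> m $ i > 0" and "\<And>m. c < Q 1 (C - inverse (real (Suc m))) (\<tau> m)"
    by metis
  then have ge: "c \<le> Q 1 (C - inverse (real (Suc m))) (\<tau> m)" for m by (simp add: less_imp_le)
  have lim: "(\<lambda>m. C - inverse (real (Suc m))) \<longlonglongrightarrow> C"
    using LIMSEQ_inverse_real_of_nat_add_minus[of C] by simp
  obtain \<tau>' v where "\<And>i. \<tau>' $ i \<ge> 0" "q 1 C (\<tau>' * v) \<noteq> 0" "c \<le> Q 1 C \<tau>'"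
    using Q_limit_point[OF tendsto_const lim neg \<tau> ge] by blast
  then show ?thesis using Q_limit_le_F order_trans by blast
qed

end

text \<open>\<open>Cs\<close> abstracts \<open>C\<^sup>*\<close>, the largest ratio at a basis
  vector. At \<open>C = Cs\<close> itself the form may vanish on such a vector.\<close>

locale critical_ratio = nondegenerate_ratio +
  fixes Cs :: real
  assumes below_Cs: "\<And>C. C < Cs \<Longrightarrow> \<exists>i. q 1 C (axis i 1) > 0"
    and above_Cs: "\<And>C i. C > Cs \<Longrightarrow> i \<in> J \<Longrightarrow> q 1 C (axis i 1) < 0"
begin

lemma F_below_Cs: "C < Cs \<Longrightarrow> F C = 1"
  using below_Cs F_eq_1 by blast

text \<open>The admissible critical values exist because \<open>F\<close> gets arbitrarily small,
  are bounded below by \<open>Cs\<close> because \<open>F\<close> is \<open>1\<close> below it, and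
  contain their infimum by right-continuity.\<close>

lemma minimal_critical_value:
  assumes "0 < \<alpha>" "\<alpha> < 1"
  obtains Cmin where "F Cmin \<le> \<alpha>" "\<And>C. F C \<le> \<alpha> \<Longrightarrow> Cmin \<le> C"
proof -
  define S where "S = {C. F C \<le> \<alpha>}"
  have ne: "S \<noteq> {}" using F_arbitrarily_small[OF assms(1)] by (auto simp: S_def)
  have bdd: "bdd_below S"
    using F_below_Cs assms(2) by (intro bdd_belowI[of _ Cs]) (force simp: S_def not_less[symmetric])
  have "F (Inf S) \<le> \<alpha>"
  proof (rule ccontr)
    assume "\<not> F (Inf S) \<le> \<alpha>"
    then obtain C where C: "Inf S < C" "\<alpha> < F C"
      using F_right_continuous[of \<alpha> "Inf S"] by auto
    then obtain C' where "C' \<in> S" "C' < C" using cInf_less_iff[OF ne bdd] by blast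
    then show False using F_antimono[of C' C] C by (simp add: S_def)
  qed
  moreover have "Inf S \<le> C" if "F C \<le> \<alpha>" for C
    using that bdd by (intro cInf_lower) (simp_all add: S_def)
  ultimately show thesis by (rule that)
qed

text \<open>Right-continuity at \<open>Cs\<close>; this identifies \<open>alpha_star\<close> with
  \<open>F Cs\<close>.\<close>

lemma F_Cs_eq_SUP: "F Cs = (SUP C\<in>{Cs<..}. F C)"
proof (rule antisym)
  have bdd: "bdd_above (F ` {Cs<..})" by (auto intro!: bdd_aboveI[of _ 1] F_le_1)
  show "F Cs \<le> (SUP C\<in>{Cs<..}. F C)"
  proof (rule dense_le)
    fix x assume "x < F Cs"
    then obtain C where "Cs < C" "x < F C" using F_right_continuous by blast
    moreover have "F C \<le> (SUP C\<in>{Cs<..}. F C)" using \<open>Cs < C\<close> bdd by (intro cSUP_upper) auto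
    ultimately show "x \<le> (SUP C\<in>{Cs<..}. F C)" by simp
  qed
  show "(SUP C\<in>{Cs<..}. F C) \<le> F Cs"
    by (intro cSUP_least) (auto intro: F_antimono)
qed

text \<open>The smallest admissible \<open>C\<close> works: below \<open>Cs\<close> the size is
  \<open>1\<close>, at \<open>Cs\<close> the bound on \<open>\<alpha>\<close> applies, and beyond
  \<open>Cs\<close> every smaller value has size above \<open>\<alpha>\<close>, which
  left-continuity transfers to \<open>C\<close>.\<close>

lemma F_attains:
  assumes "0 < \<alpha>" "\<alpha> < 1" "\<alpha> \<le> F Cs"
  shows "\<exists>C. F C = \<alpha>"
proof -
  obtain C where C: "F C \<le> \<alpha>" "\<And>C'. F C' \<le> \<alpha> \<Longrightarrow> C \<le> C'"
    using minimal_critical_value assms by blast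
  consider "C < Cs" | "C = Cs" | "C > Cs" by linarith
  then have "\<alpha> \<le> F C"
  proof cases
    case 1
    then show ?thesis using F_below_Cs assms by simp
  next
    case 3
    show ?thesis
    proof (rule F_left_continuous)
      show "q 1 C (axis i 1) \<noteq> 0" if "i \<in> J" for i using above_Cs[OF 3 that] by simp
      show "\<alpha> < F C'" if "C' < C" for C' using C(2)[of C'] that by linarith
    qed
  qed (use assms in simp)
  with C show ?thesis by (intro exI[of _ C]) simp
qed

end

section \<open>The heteroskedasticity robust test statistic\<close>

locale het_test =
  fixes X :: "real^'k^'n" and R :: "real^'k" and r :: real and d :: "real^'n"
  assumes full_rank: "rank X = CARD('k)" and R_nonzero: "R \<noteq> 0"
    and d_pos: "\<And>i. d $ i > 0" and assumption1: "assumption1 X R"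
begin

section \<open>Least squares algebra\<close>

abbreviation M :: "real^'k^'k" where
  "M \<equiv> matrix_inv (transpose X ** X)"

definition a :: "real^'n" where
  "a = R v* (M ** transpose X)"

text \<open>For a single restriction, \<open>Omega_Het\<close> is the sum of squared residuals with
  these weights.\<close>

definition w :: "real^'n" where
  "w = (\<chi> i. d $ i * (a $ i)\<^sup>2)"

lemma matrix_inv_gram: "M ** (transpose X ** X) = mat 1" "(transpose X ** X) ** M = mat 1"
proof -
  have "inj ((*v) (transpose X ** X))"
  proof (rule injI)
    fix x y assume "(transpose X ** X) *v x = (transpose X ** X) *v y"
    then have "(transpose X ** X) *v (x - y) = 0" by (simp add: matrix_vector_mult_diff_distrib)
    then have "(X *v (x - y)) v* X = 0" by (simp flip: matrix_vector_mul_assoc)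
    then have "(X *v (x - y)) \<bullet> (X *v (x - y)) = 0"
      by (metis dot_lmul_matrix inner_zero_left)
    then have "X *v x = X *v y" by (simp add: matrix_vector_mult_diff_distrib)
    then show "x = y" using full_rank full_rank_injective[of X] by (auto dest: injD)
  qed
  then obtain B where "B ** (transpose X ** X) = mat 1"
    using matrix_left_invertible_injective by (metis injD)
  then have B: "(transpose X ** X) ** B = mat 1" by (simp add: matrix_left_right_inverse)
  then have "M = B" by (rule matrix_inv_eqI)
  then show "(transpose X ** X) ** M = mat 1" using B by simp
  then show "M ** (transpose X ** X) = mat 1" by (simp add: matrix_left_right_inverse)
qed

lemma transpose_M: "transpose M = M"
proof -
  have "transpose M ** (transpose X ** X) = mat 1"
    using arg_cong[OF matrix_inv_gram(2), of transpose]
    by (simp add: matrix_transpose_mul transpose_transpose transpose_mat)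
  then have "(transpose X ** X) ** transpose M = mat 1"
    by (simp add: matrix_left_right_inverse)
  then show ?thesis using matrix_inv_eqI by metis
qed

lemma a_eq: "a = X *v (M *v R)"
proof -
  have "a = transpose (M ** transpose X) *v R" unfolding a_def by (simp only: transpose_matrix_vector)
  also have "\<dots> = X *v (M *v R)"
    by (simp add: matrix_transpose_mul transpose_M transpose_transpose matrix_vector_mul_assoc
        del: transpose_matrix_vector)
  finally show ?thesis .
qed

lemma inner_beta_hat: "R \<bullet> beta_hat X y = a \<bullet> y"
  by (simp add: beta_hat_def a_def dot_lmul_matrix)

lemma beta_hat_add: "beta_hat X (y + z) = beta_hat X y + beta_hat X z"
  by (simp add: beta_hat_def matrix_vector_right_distrib)

lemma beta_hat_image: "beta_hat X (X *v \<beta>) = \<beta>"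
  unfolding beta_hat_def
  by (simp only: matrix_vector_mul_assoc matrix_mul_assoc[symmetric] matrix_inv_gram matrix_vector_mul_lid)

lemma linear_u_hat: "linear (u_hat X)"
  by (rule linearI)
    (simp_all add: u_hat_def beta_hat_def matrix_vector_right_distrib matrix_vector_mult_scaleR algebra_simps)

lemma u_hat_image: "u_hat X (X *v \<beta>) = 0"
  by (simp add: u_hat_def beta_hat_image)

lemma u_hat_eq_0_iff: "u_hat X y = 0 \<longleftrightarrow> y \<in> range ((*v) X)"
  using u_hat_image by (auto simp: u_hat_def)

lemma span_columns: "span (columns X) = range ((*v) X)"
  using matrix_vector_mult_in_columnspace[of X] by (auto simp: columns_image_basis span_linear_image)

text \<open>Residuals are orthogonal to the column space, so only the residual part of
  \<open>axis i 1\<close> contributes to the inner product.\<close>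

lemma u_hat_axis: "u_hat X (axis i 1) $ i = (norm (u_hat X (axis i 1)))\<^sup>2"
proof -
  have "u_hat X y v* X = 0" for y
  proof -
    have "u_hat X y v* X = transpose X *v y - ((transpose X ** X) ** M) *v (transpose X *v y)"
      unfolding u_hat_def beta_hat_def transpose_matrix_vector[symmetric]
      by (simp only: matrix_vector_mult_diff_distrib matrix_vector_mul_assoc matrix_mul_assoc)
    then show ?thesis by (simp add: matrix_inv_gram)
  qed
  then have orth: "u_hat X y \<bullet> (X *v \<beta>) = 0" for y \<beta>
    by (metis dot_lmul_matrix inner_zero_left)
  have "u_hat X (axis i 1) $ i = u_hat X (axis i 1) \<bullet> axis i 1"
    by (simp add: inner_axis)
  also have "\<dots> = u_hat X (axis i 1) \<bullet> (u_hat X (axis i 1) + X *v beta_hat X (axis i 1))"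
    by (simp add: u_hat_def)
  also have "\<dots> = (norm (u_hat X (axis i 1)))\<^sup>2"
    by (simp add: inner_add_right orth power2_norm_eq_inner)
  finally show ?thesis .
qed

sublocale quadratic_ratio a w "u_hat X"
proof (rule quadratic_ratio.intro)
  show "linear (u_hat X)" by (rule linear_u_hat)
  show "w $ i \<ge> 0" for i using d_pos[of i] by (simp add: w_def)
  \<comment> \<open>\<open>X *v R\<close> has zero residuals, and its restriction value
    \<open>R \<bullet> R\<close> is nonzero.\<close>
  have "a \<bullet> (X *v R) = R \<bullet> R"
    by (simp add: beta_hat_image flip: inner_beta_hat)
  then have "a \<bullet> (X *v R) \<noteq> 0" using R_nonzero by simp
  then show "\<exists>z. a \<bullet> z \<noteq> 0 \<and> u_hat X z = 0" using u_hat_image by blast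
qed

lemma Omega_Het_eq: "Omega_Het X R d y = W y"
proof -
  define D where "D = diag (\<chi> i. d $ i * (u_hat X y $ i)\<^sup>2)"
  have "Psi_Het X d y *v R = (M ** transpose X) *v (D *v a)"
    unfolding a_eq Psi_Het_def D_def by (simp only: matrix_vector_mul_assoc matrix_mul_assoc)
  then have "Omega_Het X R d y = a \<bullet> (D *v a)"
    by (simp only: Omega_Het_def a_def dot_lmul_matrix)
  then show ?thesis
    unfolding W_def by (simp add: D_def diag_vector_mult inner_vec_def w_def power2_eq_square mult_ac)
qed

lemma W_axis_pos:
  assumes "a $ i \<noteq> 0" "u_hat X (axis i 1) \<noteq> 0"
  shows "W (axis i 1) > 0"
proof -
  have "w $ i \<noteq> 0" using assms d_pos[of i] by (simp add: w_def)
  moreover have "u_hat X (axis i 1) $ i \<noteq> 0" using assms by (simp add: u_hat_axis)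
  ultimately have "W (axis i 1) \<noteq> 0" by (auto simp: W_eq_0_iff)
  then show ?thesis using W_nonneg[of "axis i 1"] by simp
qed

text \<open>Assumption 1 in coordinates; through \<open>W_axis_pos\<close> it makes \<open>W\<close>
  not identically zero.\<close>

lemma assumption1_axis: "\<exists>i. a $ i \<noteq> 0 \<and> u_hat X (axis i 1) \<noteq> 0"
  using assumption1 by (auto simp: assumption1_def I0_def a_def span_columns u_hat_eq_0_iff)

definition T0 :: "real^'n \<Rightarrow> real" where
  "T0 z = (if W z \<noteq> 0 then (a \<bullet> z)\<^sup>2 / W z else 0)"

lemma T_Het_mean_space:
  assumes "\<mu> \<in> mean_space X R r"
  shows "T_Het X R r d (\<mu> + z) = T0 z"
proof -
  obtain \<beta> where \<beta>: "\<mu> = X *v \<beta>" "R \<bullet> \<beta> = r" using assms by (auto simp: mean_space_def)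
  have "R \<bullet> beta_hat X (\<mu> + z) = r + a \<bullet> z"
    by (simp add: beta_hat_add \<beta> beta_hat_image inner_add_right inner_beta_hat)
  moreover have "u_hat X (\<mu> + z) = u_hat X z"
    by (simp add: linear_add[OF linear_u_hat] \<beta> u_hat_image)
  then have "W (\<mu> + z) = W z" by (simp add: W_def)
  ultimately show ?thesis by (simp add: T_Het_def T0_def Omega_Het_eq)
qed

lemma T_Het_measurable: "T_Het X R r d \<in> borel_measurable borel"
proof -
  have [measurable]: "W \<in> borel_measurable borel"
    by (intro borel_measurable_continuous_onI continuous_on_W)
  show ?thesis
    unfolding T_Het_def[abs_def] Omega_Het_eq inner_beta_hat by measurable
qed

lemma q_ge_0_iff: "W z \<noteq> 0 \<Longrightarrow> q 1 C z \<ge> 0 \<longleftrightarrow> T0 z \<ge> C"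
  using W_nonneg[of z] by (simp add: q_def T0_def field_simps)

text \<open>The events for \<open>T0\<close> and for \<open>q\<close> differ only where
  \<open>W\<close> vanishes, which is a null set by Assumption 1.\<close>

lemma reject_prob_eq_Q:
  assumes \<mu>: "\<mu> \<in> mean_space X R r" and "\<sigma>2 > 0" and \<tau>: "\<And>i. \<tau> $ i \<noteq> 0"
  shows "reject_prob X R r d C \<mu> (\<sigma>2 *\<^sub>R diag (\<chi> i. (\<tau> $ i)\<^sup>2)) = Q 1 C (\<chi> i. \<bar>\<tau> $ i\<bar>)"
proof -
  interpret prob_space "std_gaussian :: (real^'n) measure" by (rule prob_space_std_gaussian)
  \<comment> \<open>Standard deviations; the absolute values matter because entries of
    \<open>\<tau>\<close> may be negative.\<close>
  define s where "s = sqrt \<sigma>2 *\<^sub>R (\<chi> i. \<bar>\<tau> $ i\<bar>)"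
  have s: "s $ i > 0" for i using assms by (simp add: s_def)
  have "\<sigma>2 *\<^sub>R diag (\<chi> i. (\<tau> $ i)\<^sup>2) = diag (\<chi> i. (s $ i)\<^sup>2)"
    using \<open>\<sigma>2 > 0\<close> by (simp add: s_def diag_def vec_eq_iff power_mult_distrib)
  then have "reject_prob X R r d C \<mu> (\<sigma>2 *\<^sub>R diag (\<chi> i. (\<tau> $ i)\<^sup>2)) =
      measure (distr std_gaussian borel (\<lambda>g. \<mu> + s * g)) {y. T_Het X R r d y \<ge> C}"
    by (simp add: reject_prob_def gaussian_diag_eq_distr[OF s])
  also have "\<dots> = prob {g. T0 (s * g) \<ge> C}"
  proof (subst measure_distr)
    have "continuous_on UNIV (\<lambda>g. \<mu> + s * g)"
      unfolding continuous_on_def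
      by (intro ballI tendsto_add tendsto_vec_times tendsto_const tendsto_ident_at)
    then show "(\<lambda>g. \<mu> + s * g) \<in> std_gaussian \<rightarrow>\<^sub>M borel"
      by (simp add: borel_measurable_continuous_onI cong: measurable_cong_sets)
    show "{y. T_Het X R r d y \<ge> C} \<in> sets borel"
      using T_Het_measurable by measurable
  qed (simp add: T_Het_mean_space[OF \<mu>] vimage_def)
  also have "\<dots> = Q 1 C s"
    unfolding Q_def
  proof (rule measure_eq_AE)
    obtain i where i: "W (axis i 1) > 0" using assumption1_axis W_axis_pos by blast
    have "s * axis i 1 = s $ i *\<^sub>R axis i 1" by (simp add: vec_eq_iff axis_def)
    then have "q 0 1 (s * axis i 1) \<noteq> 0" using i s[of i] by (simp add: q_def W_scaleR)
    from AE_q_nonzero[OF this]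
    show "AE g in std_gaussian. g \<in> {g. T0 (s * g) \<ge> C} \<longleftrightarrow> g \<in> {g. q 1 C (s * g) \<ge> 0}"
      by eventually_elim (subst (asm) q_def, simp add: q_ge_0_iff)
    have [measurable]: "(\<lambda>g. W (s * g)) \<in> borel_measurable borel"
      using q_measurable[of 0 "-1" s] by (simp add: q_def)
    have [measurable]: "(\<lambda>g. (a \<bullet> (s * g))\<^sup>2) \<in> borel_measurable borel"
      using q_measurable[of 1 0 s] by (simp add: q_def)
    show "{g. T0 (s * g) \<ge> C} \<in> events"
      unfolding T0_def by (simp, measurable)
    show "{g. q 1 C (s * g) \<ge> 0} \<in> events" by (simp, measurable)
  qed
  also have "\<dots> = Q 1 C (\<chi> i. \<bar>\<tau> $ i\<bar>)"
    unfolding s_def using \<open>\<sigma>2 > 0\<close> by (intro Q_scale) simp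
  finally show ?thesis .
qed

text \<open>The unit-sum constraint in \<open>C_Het\<close> costs nothing: dividing a scale by its
  norm leaves \<open>Q\<close> unchanged.\<close>

lemma reject_prob_image:
  assumes \<mu>: "\<mu> \<in> mean_space X R r" and "\<sigma>2 > 0"
  shows "(\<lambda>\<Sigma>. reject_prob X R r d C \<mu> (\<sigma>2 *\<^sub>R \<Sigma>)) ` C_Het = Q 1 C ` {\<tau>. \<forall>i. \<tau> $ i > 0}"
proof (intro equalityI subsetI)
  fix x assume "x \<in> (\<lambda>\<Sigma>. reject_prob X R r d C \<mu> (\<sigma>2 *\<^sub>R \<Sigma>)) ` C_Het"
  then obtain \<tau> where "\<And>i. \<tau> $ i \<noteq> 0"
      and "x = reject_prob X R r d C \<mu> (\<sigma>2 *\<^sub>R diag (\<chi> i. (\<tau> $ i)\<^sup>2))"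
    by (auto simp: C_Het_def)
  then show "x \<in> Q 1 C ` {\<tau>. \<forall>i. \<tau> $ i > 0}"
    using reject_prob_eq_Q[OF assms] by auto
next
  fix x assume "x \<in> Q 1 C ` {\<tau>. \<forall>i. \<tau> $ i > 0}"
  then obtain \<tau> where \<tau>: "\<And>i. \<tau> $ i > 0" "x = Q 1 C \<tau>" by auto
  define \<tau>' where "\<tau>' = (1 / norm \<tau>) *\<^sub>R \<tau>"
  have "\<tau> \<noteq> 0" using \<tau>(1) by (metis less_irrefl zero_index)
  then have \<tau>': "\<tau>' $ i > 0" for i using \<tau>(1) by (simp add: \<tau>'_def)
  then have \<tau>'0: "\<tau>' $ i \<noteq> 0" for i by (simp add: less_imp_neq[symmetric])
  have "norm \<tau>' = 1" using \<open>\<tau> \<noteq> 0\<close> by (simp add: \<tau>'_def)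
  then have "(\<Sum>i\<in>UNIV. (\<tau>' $ i)\<^sup>2) = 1"
    by (simp add: norm_eq_1 inner_vec_def power2_eq_square)
  then have mem: "diag (\<chi> i. (\<tau>' $ i)\<^sup>2) \<in> C_Het"
    using \<tau>'0 by (auto simp: C_Het_def)
  have "(\<chi> i. \<bar>\<tau>' $ i\<bar>) = \<tau>'" using \<tau>' by (simp add: vec_eq_iff less_imp_le)
  then have "reject_prob X R r d C \<mu> (\<sigma>2 *\<^sub>R diag (\<chi> i. (\<tau>' $ i)\<^sup>2)) = Q 1 C \<tau>'"
    using reject_prob_eq_Q[OF assms \<tau>'0] by simp
  also have "\<dots> = x" unfolding \<tau>'_def \<tau>(2) using \<open>\<tau> \<noteq> 0\<close> by (intro Q_scale) simp
  finally show "x \<in> (\<lambda>\<Sigma>. reject_prob X R r d C \<mu> (\<sigma>2 *\<^sub>R \<Sigma>)) ` C_Het"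
    using mem by blast
qed

lemma SUP_reject_prob:
  assumes "\<mu> \<in> mean_space X R r" and "\<sigma>2 > 0"
  shows "(SUP \<Sigma>\<in>C_Het. reject_prob X R r d C \<mu> (\<sigma>2 *\<^sub>R \<Sigma>)) = F C"
  using reject_prob_image[OF assms] by (simp add: F_def)

lemma mean_space_nonempty: "mean_space X R r \<noteq> {}"
proof -
  have "R \<bullet> ((r / (R \<bullet> R)) *\<^sub>R R) = r" using R_nonzero by simp
  then show ?thesis unfolding mean_space_def by blast
qed

lemma test_size_eq_F: "test_size X R r d C = F C"
  unfolding test_size_def using mean_space_nonempty by (simp add: SUP_reject_prob)

lemma alpha_star_eq:
  assumes "\<mu> \<in> mean_space X R r"
  shows "alpha_star X R r d \<mu> = (SUP C\<in>{C_star X R r d \<mu><..}. F C)"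
  unfolding alpha_star_def using SUP_reject_prob[OF assms, of 1] by simp

lemma C_star_eq:
  assumes "\<mu> \<in> mean_space X R r"
  shows "C_star X R r d \<mu> = Max ((\<lambda>i. T0 (axis i 1)) ` I1 (mean_space_lin X R))"
  unfolding C_star_def T_Het_mean_space[OF assms] by (simp add: setcompr_eq_image)

section \<open>Index sets, conditions (N) and (N'), and \<open>C_star\<close>\<close>

lemma inner_a_axis: "a \<bullet> axis i 1 = a $ i"
  by (simp add: inner_axis)

text \<open>If \<open>axis i 1 = X *v \<beta>\<close>, then \<open>\<beta>\<close> is its least
  squares coefficient, so \<open>R \<bullet> \<beta> = a $ i\<close>.\<close>

lemma I1_iff: "i \<in> I1 (mean_space_lin X R) \<longleftrightarrow> u_hat X (axis i 1) \<noteq> 0 \<or> a $ i \<noteq> 0"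
proof -
  have "axis i 1 \<in> mean_space_lin X R \<longleftrightarrow> u_hat X (axis i 1) = 0 \<and> a $ i = 0"
    unfolding u_hat_eq_0_iff inner_a_axis[symmetric] mean_space_lin_def
    by (auto simp: beta_hat_image simp flip: inner_beta_hat)
  then show ?thesis by (auto simp: I1_def I0_def)
qed

text \<open>Indices with \<open>a $ i = 0\<close> drop out: they belong to \<open>I1\<close> only if
  the residual is already nonzero.\<close>

lemma cond_N_iff: "cond_N X R \<longleftrightarrow> (\<forall>i. a $ i \<noteq> 0 \<longrightarrow> u_hat X (axis i 1) \<noteq> 0)"
  by (auto simp: cond_N_def I1_iff span_columns simp flip: u_hat_eq_0_iff)

text \<open>By \<open>u_hat_axis\<close> a diagonal entry of the hat matrix is \<open>1\<close>
  minus the squared norm of a residual vector.\<close>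

lemma cond_N'_iff: "cond_N' X R \<longleftrightarrow> (\<forall>i. a $ i \<noteq> 0 \<longrightarrow> u_hat X (axis i 1) \<noteq> 0)"
proof -
  have "transpose X *v axis i 1 = row i X" for i
    by (simp add: matrix_vector_mult_basis del: transpose_matrix_vector)
  then have "R \<bullet> (M *v row i X) = R \<bullet> ((M ** transpose X) *v axis i 1)" for i
    by (metis matrix_vector_mul_assoc)
  then have 1: "R \<bullet> (M *v row i X) = a $ i" for i
    by (metis a_def inner_a_axis dot_lmul_matrix)
  have "u_hat X (axis i 1) = axis i 1 - hat_matrix X *v axis i 1" for i
    by (simp add: u_hat_def beta_hat_def hat_matrix_def matrix_vector_mul_assoc matrix_mul_assoc)
  then have "u_hat X (axis i 1) $ i = 1 - hat_matrix X $ i $ i" for i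
    by (simp add: matrix_vector_mult_basis column_def)
  then have "hat_matrix X $ i $ i = 1 - (norm (u_hat X (axis i 1)))\<^sup>2" for i
    using u_hat_axis[of i] by simp
  then show ?thesis unfolding cond_N'_def 1 by simp
qed

lemma critical_ratio:
  assumes N: "cond_N X R" and \<mu>: "\<mu> \<in> mean_space X R r"
  shows "critical_ratio a w (u_hat X) (C_star X R r d \<mu>)"
proof -
  interpret N: nondegenerate_ratio a w "u_hat X"
    using N W_axis_pos by unfold_locales (auto simp: cond_N_iff)
  define I where "I = I1 (mean_space_lin X R)"
  define Cs where "Cs = C_star X R r d \<mu>"
  have Cs: "Cs = Max ((\<lambda>i. T0 (axis i 1)) ` I)"
    using C_star_eq[OF \<mu>] by (simp add: I_def Cs_def)
  have le: "T0 (axis i 1) \<le> Cs" if "i \<in> I" for i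
    unfolding Cs using that by simp
  obtain j where j: "a $ j \<noteq> 0" "u_hat X (axis j 1) \<noteq> 0" using assumption1_axis by blast
  then have "j \<in> I" by (simp add: I_def I1_iff)
  have "T0 (axis j 1) > 0" using j W_axis_pos[OF j] by (simp add: T0_def inner_a_axis)
  \<comment> \<open>Assumption 1 makes the maximum positive, so it is not the default value
    \<open>0\<close> of \<open>T0\<close>, and a maximizing index has
    \<open>W (axis i 1) > 0\<close>.\<close>
  with le[OF \<open>j \<in> I\<close>] have Cs_pos: "Cs > 0" by simp
  have "Cs \<in> (\<lambda>i. T0 (axis i 1)) ` I" unfolding Cs using \<open>j \<in> I\<close> by (intro Max_in) auto
  then obtain i where i: "i \<in> I" "Cs = T0 (axis i 1)" by blast
  show ?thesis unfolding Cs_def[symmetric]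
  proof unfold_locales
    fix C assume C: "C < Cs"
    have W: "W (axis i 1) > 0" using Cs_pos i W_nonneg[of "axis i 1"] by (auto simp: T0_def split: if_splits)
    then have "C * W (axis i 1) < (a \<bullet> axis i 1)\<^sup>2" using C i by (simp add: T0_def field_simps)
    then show "\<exists>i. q 1 C (axis i 1) > 0" by (auto simp: q_def)
  next
    fix C i assume C: "C > Cs" and "i \<in> N.J"
    then have W: "W (axis i 1) > 0" by (simp add: N.J_def)
    then have "u_hat X (axis i 1) \<noteq> 0" by (auto simp: W_def)
    then have "T0 (axis i 1) < C" using le[of i] C by (simp add: I_def I1_iff)
    then show "q 1 C (axis i 1) < 0" using W by (simp add: T0_def q_def field_simps)
  qed
qed

text \<open>Some basis vector in the column space has \<open>a $ i \<noteq> 0\<close>;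
  \<open>W\<close> is zero there, so no \<open>C\<close> can offset the numerator.\<close>

lemma F_eq_1_of_not_cond_N:
  assumes "\<not> cond_N X R"
  shows "F C = 1"
proof -
  obtain i where "a $ i \<noteq> 0" "u_hat X (axis i 1) = 0"
    using assms by (auto simp: cond_N_iff)
  then have "q 1 C (axis i 1) > 0" by (simp add: q_def inner_a_axis W_def)
  then show ?thesis by (rule F_eq_1)
qed

end

theorem theorem2p2:
  fixes X :: "real^'k^'n" and R :: "real^'k" and r :: real and d :: "real^'n"
  assumes "CARD('k) < CARD('n)"
    and "rank X = CARD('k)"
    and "R \<noteq> 0"
    and "\<forall>i. d $ i > 0"
    and "assumption1 X R"
  shows
    "(cond_N X R \<longleftrightarrow> cond_N' X R)
   \<and> \<comment> \<open>Part 1\<close>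
     (cond_N X R \<longrightarrow>
        (\<forall>\<alpha>. 0 < \<alpha> \<and> \<alpha> < 1 \<longrightarrow> (\<exists>C. test_size X R r d C \<le> \<alpha>))
      \<and> (\<forall>\<mu>\<^sub>0\<in>mean_space X R r. \<forall>\<mu>\<^sub>1\<in>mean_space X R r.
           C_star X R r d \<mu>\<^sub>0 = C_star X R r d \<mu>\<^sub>1 \<and>
           alpha_star X R r d \<mu>\<^sub>0 = alpha_star X R r d \<mu>\<^sub>1)
      \<and> (\<forall>\<mu>\<^sub>0\<in>mean_space X R r. alpha_star X R r d \<mu>\<^sub>0 > 0 \<and>
           (\<forall>\<alpha>. \<alpha> \<in> {0<..alpha_star X R r d \<mu>\<^sub>0} \<inter> {0<..<1} \<longrightarrow>
              (\<exists>C. test_size X R r d C = \<alpha>))))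
   \<and> \<comment> \<open>Part 2\<close>
     (cond_N X R \<longrightarrow>
        (\<forall>\<alpha>. 0 < \<alpha> \<and> \<alpha> < 1 \<longrightarrow>
          (\<exists>Cmin. test_size X R r d Cmin \<le> \<alpha>
             \<and> (\<forall>C. test_size X R r d C \<le> \<alpha> \<longrightarrow> Cmin \<le> C)
             \<and> ((\<exists>C. test_size X R r d C = \<alpha>) \<longrightarrow>
                  test_size X R r d Cmin = \<alpha> \<and>
                  (\<forall>C. test_size X R r d C = \<alpha> \<longrightarrow> Cmin \<le> C)))))
   \<and> \<comment> \<open>Part 3\<close>
     (cond_N X R \<longrightarrow>
        (\<forall>\<mu>\<^sub>0\<in>mean_space X R r.
          (\<forall>\<alpha> C. 0 < \<alpha> \<and> \<alpha> < 1 \<and> test_size X R r d C \<le> \<alpha> \<longrightarrow> C \<ge> C_star X R r d \<mu>\<^sub>0)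
        \<and> (\<forall>C < C_star X R r d \<mu>\<^sub>0. \<forall>\<mu>\<in>mean_space X R r. \<forall>\<sigma>2>0.
             (SUP \<Sigma>\<in>C_Het. reject_prob X R r d C \<mu> (\<sigma>2 *\<^sub>R \<Sigma>)) = 1)))
   \<and> \<comment> \<open>Part 4\<close>
     (\<not> cond_N X R \<longrightarrow>
        (\<forall>C. \<forall>\<mu>\<^sub>0\<in>mean_space X R r. \<forall>\<sigma>2>0.
           (SUP \<Sigma>\<in>C_Het. reject_prob X R r d C \<mu>\<^sub>0 (\<sigma>2 *\<^sub>R \<Sigma>)) = 1)
      \<and> (\<forall>C. test_size X R r d C = 1))"
proof -
  interpret het_test X R r d using assms by unfold_locales auto
  have N_iff: "cond_N X R \<longleftrightarrow> cond_N' X R" by (simp only: cond_N_iff cond_N'_iff)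
  obtain \<nu> where \<nu>: "\<nu> \<in> mean_space X R r" using mean_space_nonempty by blast
  have C_star_const: "C_star X R r d \<mu> = C_star X R r d \<nu>" if "\<mu> \<in> mean_space X R r" for \<mu>
    by (simp add: C_star_eq[OF that] C_star_eq[OF \<nu>])
  have not_N: "\<forall>C. F C = 1" if "\<not> cond_N X R"
    using F_eq_1_of_not_cond_N[OF that] by blast
  show ?thesis
  proof (cases "cond_N X R")
    case True
    interpret critical_ratio a w "u_hat X" "C_star X R r d \<nu>"
      using critical_ratio[OF True \<nu>] .
    have alpha_star: "alpha_star X R r d \<mu> = F (C_star X R r d \<nu>)" if "\<mu> \<in> mean_space X R r" for \<mu>
      by (simp add: alpha_star_eq[OF that] C_star_const[OF that] F_Cs_eq_SUP)
    have part2: "\<exists>Cmin. F Cmin \<le> \<alpha> \<and> (\<forall>C. F C \<le> \<alpha> \<longrightarrow> Cmin \<le> C)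
        \<and> ((\<exists>C. F C = \<alpha>) \<longrightarrow> F Cmin = \<alpha> \<and> (\<forall>C. F C = \<alpha> \<longrightarrow> Cmin \<le> C))"
      if \<alpha>: "0 < \<alpha>" "\<alpha> < 1" for \<alpha>
    proof -
      obtain Cmin where Cmin: "F Cmin \<le> \<alpha>" "\<And>C. F C \<le> \<alpha> \<Longrightarrow> Cmin \<le> C"
        using minimal_critical_value[OF \<alpha>] by blast
      \<comment> \<open>Any \<open>C\<close> with equality is at least \<open>Cmin\<close>, so
        monotonicity gives \<open>\<alpha> = F C \<le> F Cmin\<close>.\<close>
      have "F Cmin = \<alpha>" if "F C = \<alpha>" for C
        using Cmin(1) F_antimono[OF Cmin(2)[of C]] that by simp
      then show ?thesis using Cmin by (intro exI[of _ Cmin]) auto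
    qed
    have ge: "C_star X R r d \<nu> \<le> C" if "F C \<le> \<alpha>" "\<alpha> < 1" for C \<alpha>
      using F_below_Cs[of C] that by (force simp: not_less[symmetric])
    show ?thesis
      using True N_iff
      by (auto simp: test_size_eq_F SUP_reject_prob alpha_star C_star_const F_pos part2
          F_arbitrarily_small F_attains F_below_Cs intro: ge)
  next
    case False
    then show ?thesis using N_iff not_N by (auto simp: test_size_eq_F SUP_reject_prob)
  qed
qed

end
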